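(* Let $A$ be a Dedekind domain with field of fractions $K$, let $L/K$ be a finite separable field extension, and let $B$ be the integral closure of $A$ in $L$. If $\mathfrak{b}$ is an ideal of $B$ of degree one, then each of its prime ideal factors is of degree one. Moreover, if $\mathfrak{q}_1,\dots,\mathfrak{q}_r$ ($r\ge 1$) are non-zero prime ideals of $B$ lying over distinct primes of $A$ (i.e., $A\cap\mathfrak{q}_i\neq A\cap\mathfrak{q}_j$ for $i\neq j$), and each $\mathfrak{q}_i$ is of degree one and has ramification index one, then $\mathfrak{q}_1^{e_1}\cdots\mathfrak{q}_r^{e_r}$ is of degree one for any positive integers $e_1,\dots,e_r$.
   Context: A proper ideal $\mathfrak{b}$ of $B$ is of degree one (over $A$) if $A+\mathfrak{b}=B$, equivalently if the natural map $A/(A\cap\mathfrak{b})\to B/\mathfrak{b}$ is an isomorphism. A prime ideal factor of $\mathfrak{b}$ is a non-zero prime ideal $\mathfrak{q}$ of $B$ with $\mathfrak{b}=\mathfrak{q}\mathfrak{b}'$ for some ideal $\mathfrak{b}'$. A non-zero prime ideal $\mathfrak{q}$ of $B$ has ramification index one (over $A$) if it appears with exponent $1$ in the prime ideal factorisation of $(A\cap\mathfrak{q})B$. *)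

theory Defs
  imports "HOL-Algebra.Algebra"
begin

text \<open>
  Polynomials of HOL-Algebra are coefficient lists with the leading coefficient first; the zero
  polynomial is the empty list, whose leading coefficient is unspecified.
\<close>

definition (in ring) integral_over :: "'a set \<Rightarrow> 'a \<Rightarrow> bool"
  where "integral_over A x \<longleftrightarrow>
           (\<exists>p \<in> carrier (A[X]). p \<noteq> [] \<and> lead_coeff p = \<one> \<and> eval p x = \<zero>)"

definition (in ring) integral_closure :: "'a set \<Rightarrow> 'a set \<Rightarrow> 'a set"
  where "integral_closure A E = { x \<in> E. integral_over A x }"

text \<open>The field of fractions of a subring of a field, realised inside that field.\<close>

definition (in field) fraction_field :: "'a set \<Rightarrow> 'a set"
  where "fraction_field A = { a \<otimes> inv b | a b. a \<in> A \<and> b \<in> A \<and> b \<noteq> \<zero> }"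

text \<open>
  A Dedekind domain is a noetherian integrally closed domain in which every non-zero prime ideal
  is maximal; with this convention a field is a (trivial) Dedekind domain.
\<close>

definition (in field) dedekind_subdomain :: "'a set \<Rightarrow> bool"
  where "dedekind_subdomain A \<longleftrightarrow>
           subring A R \<and>
           noetherian_domain (R \<lparr> carrier := A \<rparr>) \<and>
           integral_closure A (fraction_field A) = A \<and>
           (\<forall>P. primeideal P (R \<lparr> carrier := A \<rparr>) \<and> P \<noteq> { \<zero> }
                  \<longrightarrow> maximalideal P (R \<lparr> carrier := A \<rparr>))"

text \<open>
  A non-zero polynomial is separable if it has no repeated root in an algebraic closure. The map
  \<^term>\<open>ring.indexed_const\<close> is the embedding of a field into its library algebraic closure.
\<close>

definition (in field) separable_polynomial :: "'a list \<Rightarrow> bool"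
  where "separable_polynomial p \<longleftrightarrow>
           p \<noteq> [] \<and>
           (\<forall>z \<in> carrier alg_closure. ring.alg_mult alg_closure (map indexed_const p) z \<le> 1)"

definition (in field) separable_extension :: "'a set \<Rightarrow> bool"
  where "separable_extension K \<longleftrightarrow>
           (\<forall>x \<in> carrier R. (algebraic over K) x \<and> separable_polynomial (Irr K x))"

definition nonzero_prime_ideal :: "('a, 'b) ring_scheme \<Rightarrow> 'a set \<Rightarrow> bool"
  where "nonzero_prime_ideal B q \<longleftrightarrow> primeideal q B \<and> q \<noteq> { \<zero>\<^bsub>B\<^esub> }"

definition degree_one :: "('a, 'b) ring_scheme \<Rightarrow> 'a set \<Rightarrow> 'a set \<Rightarrow> bool"
  where "degree_one B A b \<longleftrightarrow> ideal b B \<and> b \<noteq> carrier B \<and> A <+>\<^bsub>B\<^esub> b = carrier B"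

definition prime_ideal_factor :: "('a, 'b) ring_scheme \<Rightarrow> 'a set \<Rightarrow> 'a set \<Rightarrow> bool"
  where "prime_ideal_factor B q b \<longleftrightarrow>
           nonzero_prime_ideal B q \<and> (\<exists>b'. ideal b' B \<and> b = q \<cdot>\<^bsub>B\<^esub> b')"

text \<open>
  The function \<open>n\<close> assigns to every non-zero prime ideal its exponent, and is \<open>0\<close> at all but
  finitely many arguments and at every set that is not a non-zero prime ideal.
\<close>

definition prime_ideal_factorisation ::
    "('a, 'b) ring_scheme \<Rightarrow> 'a set \<Rightarrow> ('a set \<Rightarrow> nat) \<Rightarrow> bool"
  where "prime_ideal_factorisation B b n \<longleftrightarrow>
           finite { p. n p \<noteq> 0 } \<and>
           (\<forall>p. n p \<noteq> 0 \<longrightarrow> nonzero_prime_ideal B p) \<and>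
           b = (\<Otimes>\<^bsub>ideals_set B\<^esub>p\<in>{ p. n p \<noteq> 0 }. p [^]\<^bsub>ideals_set B\<^esub> n p)"

text \<open>
  When \<open>B\<close> is a Dedekind domain the factorisation is unique, so the existential quantifier below
  merely names it.
\<close>

definition has_ramification_index ::
    "('a, 'b) ring_scheme \<Rightarrow> 'a set \<Rightarrow> 'a set \<Rightarrow> nat \<Rightarrow> bool"
  where "has_ramification_index B A q e \<longleftrightarrow>
           (\<exists>n. prime_ideal_factorisation B (Idl\<^bsub>B\<^esub> (A \<inter> q)) n \<and> n q = e)"

end

theory Submission
  imports Defs
begin

text \<open>
  Incomparability of primes in an integral extension, with the maximality of the non-zero primes of
  \<open>A\<close>, shows that a non-zero prime of \<open>B\<close> contains no other one. Let \<open>\<qq>\<close> be of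
  degree one with ramification index one and \<open>\<pp> = A \<inter> \<qq>\<close>. Then \<open>\<pp>B = \<qq>\<cc>\<close> with \<open>\<cc>\<close> a product of primes different from \<open>\<qq>\<close>, so \<open>\<cc>\<close> is
  comaximal to \<open>\<qq>\<close> and \<open>\<qq> = \<pp>B + \<qq>\<^sup>2 = \<pp> + \<qq>\<^sup>2\<close>. Multiplying out gives
  \<open>\<qq>\<^sup>e \<subseteq> A + \<qq>\<^sup>e\<^sup>+\<^sup>1\<close> for all \<open>e\<close>, whence \<open>A + \<qq>\<^sup>e = B\<close>. Powers of primes over distinct primes of
  \<open>A\<close> are comaximal already within \<open>A\<close>, and the Chinese remainder argument with
  coefficients in \<open>A\<close> handles their product.
\<close>

section \<open>The multiplicative monoid of ideals, and primes containing a product\<close>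

lemma ideals_set_simps [simp]:
  "carrier (ideals_set R) = {I. ideal I R}"
  "monoid.mult (ideals_set R) = ideal_prod R"
  "monoid.one (ideals_set R) = carrier R"
  by (simp_all add: ideals_set_def)

lemma (in cring) ideal_pow_closed:
  assumes "ideal I R"
  shows "ideal (I [^]\<^bsub>ideals_set R\<^esub> (n::nat)) R"
proof -
  interpret M: comm_monoid "ideals_set R" by (rule ideals_set_is_comm_monoid)
  show ?thesis using M.nat_pow_closed[of I n] assms by simp
qed

lemma (in cring) ideal_pow_Suc:
  assumes "ideal I R"
  shows "I [^]\<^bsub>ideals_set R\<^esub> Suc n = I \<cdot> (I [^]\<^bsub>ideals_set R\<^esub> n)"
proof -
  interpret M: comm_monoid "ideals_set R" by (rule ideals_set_is_comm_monoid)
  show ?thesis using M.nat_pow_Suc2[of I n] assms by simp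
qed

lemma (in primeideal) ideal_prod_subset_prime:
  assumes "ideal J R" "ideal J' R" "J \<cdot> J' \<subseteq> I"
  shows "J \<subseteq> I \<or> J' \<subseteq> I"
proof (rule ccontr)
  assume "\<not> ?thesis"
  then obtain x y where "x \<in> J" "x \<notin> I" "y \<in> J'" "y \<notin> I" by blast
  moreover from this have "x \<otimes> y \<in> I" using assms(3) ideal_prod.prod by fast
  ultimately show False
    using I_prime[of x y] ideal.Icarr[OF assms(1)] ideal.Icarr[OF assms(2)] by blast
qed

lemma (in primeideal) ideal_pow_subset_prime:
  assumes "ideal J R" "J [^]\<^bsub>ideals_set R\<^esub> (n::nat) \<subseteq> I"
  shows "J \<subseteq> I"
  using assms(2)
proof (induct n)
  case 0
  \<comment> \<open>The zeroth power is the unit ideal, which is contained in no prime.\<close>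
  then have "carrier R \<subseteq> I" by simp
  then show ?case using I_notcarr Icarr by blast
next
  case (Suc n)
  then show ?case
    using ideal_prod_subset_prime[OF assms(1) ideal_pow_closed[OF assms(1)]]
      ideal_pow_Suc[OF assms(1)] by auto
qed

lemma (in cring) finprod_ideal:
  assumes "\<And>i. i \<in> F \<Longrightarrow> ideal (f i) R"
  shows "ideal (\<Otimes>\<^bsub>ideals_set R\<^esub>i\<in>F. f i) R"
proof -
  interpret M: comm_monoid "ideals_set R" by (rule ideals_set_is_comm_monoid)
  show ?thesis using M.finprod_closed[of f F] assms by auto
qed

lemma (in cring) finprod_ideal_empty: "(\<Otimes>\<^bsub>ideals_set R\<^esub>i\<in>{}. f i) = carrier R"
  by (simp add: comm_monoid.finprod_empty[OF ideals_set_is_comm_monoid])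

lemma (in cring) finprod_ideal_insert:
  assumes "finite F" "i \<notin> F" "\<And>j. j \<in> insert i F \<Longrightarrow> ideal (f j) R"
  shows "(\<Otimes>\<^bsub>ideals_set R\<^esub>j\<in>insert i F. f j) = f i \<cdot> (\<Otimes>\<^bsub>ideals_set R\<^esub>j\<in>F. f j)"
proof -
  interpret M: comm_monoid "ideals_set R" by (rule ideals_set_is_comm_monoid)
  show ?thesis using M.finprod_insert[of F i f] assms by auto
qed

lemma (in primeideal) ideal_finprod_subset_prime:
  assumes "finite F" "\<And>p. p \<in> F \<Longrightarrow> ideal (f p) R"
    and "(\<Otimes>\<^bsub>ideals_set R\<^esub>p\<in>F. f p) \<subseteq> I"
  shows "\<exists>p\<in>F. f p \<subseteq> I"
  using assms
proof (induct F)
  case empty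
  then have "carrier R \<subseteq> I" by (simp add: finprod_ideal_empty)
  then show ?case using I_notcarr Icarr by blast
next
  case (insert p F)
  have ideal: "ideal (f p) R" "ideal (\<Otimes>\<^bsub>ideals_set R\<^esub>p\<in>F. f p) R"
    using insert.prems(1) finprod_ideal[of F f] by simp_all
  have "f p \<cdot> (\<Otimes>\<^bsub>ideals_set R\<^esub>p\<in>F. f p) \<subseteq> I"
    using finprod_ideal_insert[OF insert.hyps(1,2), of f] insert.prems by simp
  then have "f p \<subseteq> I \<or> (\<Otimes>\<^bsub>ideals_set R\<^esub>p\<in>F. f p) \<subseteq> I"
    by (rule ideal_prod_subset_prime[OF ideal])
  then show ?case using insert.hyps(3) insert.prems(1) by auto
qed

lemma (in ring) ideal_add_mem_iff:
  assumes "ideal I R" "x \<in> I" "y \<in> carrier R"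
  shows "x \<oplus> y \<in> I \<longleftrightarrow> y \<in> I"
proof -
  interpret ideal I R by fact
  have y: "y = \<ominus> x \<oplus> (x \<oplus> y)" using assms(2,3) by (simp add: a_assoc[symmetric] l_neg)
  show ?thesis
  proof
    assume "x \<oplus> y \<in> I"
    then have "\<ominus> x \<oplus> (x \<oplus> y) \<in> I" using assms(2) by simp
    then show "y \<in> I" using y by simp
  qed (use assms(2) in simp)
qed

text \<open>Enlarging \<open>b\<close> can only enlarge \<open>A + b\<close>. This yields the first
  claim of the theorem, because a prime ideal factor of \<open>b\<close> contains
  \<open>b\<close>.\<close>

lemma (in ring) degree_one_mono:
  assumes "A \<subseteq> carrier R" "degree_one R A b" "b \<subseteq> q" "ideal q R" "q \<noteq> carrier R"
  shows "degree_one R A q"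
proof -
  have "A <+>\<^bsub>R\<^esub> b \<subseteq> A <+>\<^bsub>R\<^esub> q" using assms(3) unfolding set_add_def' by blast
  then have "carrier R \<subseteq> A <+>\<^bsub>R\<^esub> q" using assms(2) by (simp add: degree_one_def)
  moreover have "A <+>\<^bsub>R\<^esub> q \<subseteq> carrier R"
    using assms(1) additive_subgroup.a_subset[OF ideal.axioms(1)[OF assms(4)]]
    by (auto simp: set_add_def')
  ultimately show ?thesis using assms(4,5) by (auto simp: degree_one_def)
qed

section \<open>Integral extensions: contraction and incomparability of primes\<close>

locale integral_ring_extension = domain B for B (structure) +
  fixes A
  assumes subring: "subring A B"
    and integral: "x \<in> carrier B \<Longrightarrow> integral_over A x"
    and nonzero_prime_maximal:
      "primeideal P (B \<lparr> carrier := A \<rparr>) \<Longrightarrow> P \<noteq> {\<zero>} \<Longrightarrow> maximalideal P (B \<lparr> carrier := A \<rparr>)"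
begin

abbreviation base :: "('a, 'b) ring_scheme"
  where "base \<equiv> B \<lparr> carrier := A \<rparr>"

lemma in_carrier [simp]: "a \<in> A \<Longrightarrow> a \<in> carrier B"
  using subringE(1)[OF subring] by blast

lemma base_cring: "cring base"
  using subcring_iff[OF subringE(1)[OF subring]] subcringI'[OF subring] by simp

lemma contraction_primeideal:
  assumes "primeideal q B"
  shows "primeideal (A \<inter> q) base"
proof -
  interpret q: primeideal q B by fact
  interpret base: cring base by (rule base_cring)
  \<comment> \<open>The contraction is the preimage under the inclusion of \<open>A\<close>, so
    primality is inherited from the general result on preimages.\<close>
  have "id \<in> ring_hom base B" by (auto intro!: ring_hom_memI)
  then interpret ring_hom_ring base B id
    by (rule ring_hom_ringI2[OF base.ring_axioms ring_axioms])
  have "primeideal {a \<in> carrier base. id a \<in> q} base"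
    by (rule primeideal_vimage[OF base_cring assms])
  then show ?thesis by (simp add: Int_def)
qed

lemma incomparable_primes:
  assumes P: "primeideal P B" and Q: "ideal Q B" and "P \<subset> Q"
  shows "\<exists>a \<in> A \<inter> Q. a \<notin> P"
proof (rule ccontr)
  assume contr: "\<not> ?thesis"
  interpret P: primeideal P B by fact
  interpret Q: ideal Q B by fact
  obtain x where x: "x \<in> Q" "x \<notin> P" using assms(3) by blast
  then have xB [simp]: "x \<in> carrier B" using Q.Icarr by blast
  \<comment> \<open>The constant coefficient of a monic polynomial with value in \<open>P\<close> lies in \<open>A \<inter> Q \<subseteq> P\<close>; dropping
    it and cancelling \<open>x \<notin> P\<close> leaves a shorter one.\<close>
  have no_poly: "eval p x \<notin> P" if "set p \<subseteq> A" "p \<noteq> []" "lead_coeff p = \<one>" for p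
    using that
  proof (induct p rule: rev_induct)
    case Nil
    then show ?case by simp
  next
    case (snoc a p)
    have pB: "set p \<subseteq> carrier B" "a \<in> carrier B" using snoc.prems by auto
    then have ev: "eval (p @ [a]) x = eval p x \<otimes> x \<oplus> a" by (intro eval_append_aux) auto
    have evB [simp]: "eval p x \<in> carrier B" using eval_in_carrier pB by simp
    show ?case
    proof
      assume mem: "eval (p @ [a]) x \<in> P"
      show False
      proof (cases "p = []")
        case True
        \<comment> \<open>The polynomial is the constant \<open>a\<close> and also monic, so its
          value is \<open>\<one>\<close>.\<close>
        then have "\<one> \<in> P" using mem snoc.prems by simp
        then show False using P.I_notcarr P.one_imp_carrier by simp
      next
        case False
        have "eval p x \<otimes> x \<in> Q" using x Q.I_l_closed by simp
        moreover have "eval p x \<otimes> x \<oplus> a \<in> Q" using mem ev \<open>P \<subset> Q\<close> by auto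
        ultimately have "a \<in> Q" using ideal_add_mem_iff[OF Q] pB by blast
        then have "a \<in> P" using contr snoc.prems by auto
        moreover have "a \<oplus> eval p x \<otimes> x \<in> P" using mem ev pB by (simp add: a_comm)
        ultimately have "eval p x \<otimes> x \<in> P"
          using ideal_add_mem_iff[OF P.is_ideal] by simp
        then have "eval p x \<in> P" using P.I_prime[of "eval p x" x] x by simp
        then show False using snoc False by simp
      qed
    qed
  qed
  obtain p where p: "p \<in> carrier (A[X])" "p \<noteq> []" "lead_coeff p = \<one>" "eval p x = \<zero>"
    using integral[OF xB] by (auto simp: integral_over_def)
  then have "set p \<subseteq> A" by (simp add: univ_poly_def polynomial_def)
  then show False using no_poly[of p] p P.zero_closed by simp
qed

lemma contraction_maximalideal:
  assumes "nonzero_prime_ideal B q"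
  shows "maximalideal (A \<inter> q) base"
proof (rule nonzero_prime_maximal)
  interpret q: primeideal q B using assms by (simp add: nonzero_prime_ideal_def)
  show "primeideal (A \<inter> q) base" by (rule contraction_primeideal) (rule q.primeideal)
  \<comment> \<open>Incomparability with the zero ideal as the smaller prime: a non-zero prime of
    \<open>B\<close> has non-zero contraction, to which the maximality assumption on
    \<open>A\<close> applies.\<close>
  have "{\<zero>} \<subset> q" using assms q.zero_closed by (auto simp: nonzero_prime_ideal_def)
  from incomparable_primes[OF zeroprimeideal q.is_ideal this] show "A \<inter> q \<noteq> {\<zero>}" by auto
qed

text \<open>The contraction of \<open>q'\<close> is already maximal, so the two contractions
  coincide; by incomparability a strict inclusion would give an element of \<open>A\<close>
  separating them. This plays the part of one-dimensionality of \<open>B\<close>.\<close>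

lemma nonzero_primes_eq:
  assumes "nonzero_prime_ideal B q" "nonzero_prime_ideal B q'" "q' \<subseteq> q"
  shows "q' = q"
proof (rule ccontr)
  interpret q: primeideal q B using assms by (simp add: nonzero_prime_ideal_def)
  interpret q': primeideal q' B using assms by (simp add: nonzero_prime_ideal_def)
  interpret m: maximalideal "A \<inter> q'" base using contraction_maximalideal assms by simp
  interpret p: primeideal "A \<inter> q" base using contraction_primeideal[OF q.primeideal] .
  assume "q' \<noteq> q"
  then obtain a where "a \<in> A \<inter> q" "a \<notin> q'"
    using incomparable_primes[OF q'.primeideal q.is_ideal] assms(3) by blast
  then show False
    using m.I_maximal[OF p.is_ideal] assms(3) p.I_notcarr by auto
qed

section \<open>Comaximality witnessed by elements of \<open>A\<close>\<close>

lemma maximal_base_comaximal: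
  assumes "maximalideal p base" "ideal J base" "\<not> J \<subseteq> p"
  shows "\<exists>u \<in> J. \<exists>v \<in> p. u \<oplus> v = \<one>"
proof -
  interpret base: cring base by (rule base_cring)
  interpret p: maximalideal p base by fact
  interpret J: ideal J base by fact
  have sum: "J <+>\<^bsub>base\<^esub> p = {u \<oplus> v | u v. u \<in> J \<and> v \<in> p}"
    by (auto simp: set_add_def')
  have JA: "J \<subseteq> A" and pA: "p \<subseteq> A" using J.a_subset p.a_subset by simp_all
  have "ideal (J <+>\<^bsub>base\<^esub> p) base" by (rule base.add_ideals[OF J.is_ideal p.is_ideal])
  moreover have "p \<subseteq> J <+>\<^bsub>base\<^esub> p"
  proof
    fix v assume v: "v \<in> p"
    then have "v \<in> carrier B" using pA by auto
    then have "\<zero> \<oplus> v = v" by simp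
    then show "v \<in> J <+>\<^bsub>base\<^esub> p" using J.zero_closed v unfolding sum by force
  qed
  moreover have "J \<subseteq> J <+>\<^bsub>base\<^esub> p"
  proof
    fix u assume u: "u \<in> J"
    then have "u \<in> carrier B" using JA by auto
    then have "u \<oplus> \<zero> = u" by simp
    then show "u \<in> J <+>\<^bsub>base\<^esub> p" using p.zero_closed u unfolding sum by force
  qed
  moreover have "J <+>\<^bsub>base\<^esub> p \<subseteq> A"
    using JA pA subringE(7)[OF subring] unfolding sum by auto
  ultimately have "J <+>\<^bsub>base\<^esub> p = A"
    using p.I_maximal[of "J <+>\<^bsub>base\<^esub> p"] assms(3) by auto
  then have "\<one> \<in> J <+>\<^bsub>base\<^esub> p" using subringE(3)[OF subring] by simp
  then show ?thesis unfolding sum by force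
qed

lemma contraction_ideal:
  assumes "ideal J B"
  shows "ideal (A \<inter> J) base"
proof -
  interpret base: cring base by (rule base_cring)
  have "id \<in> ring_hom base B" by (auto intro!: ring_hom_memI)
  then interpret ring_hom_ring base B id
    by (rule ring_hom_ringI2[OF base.ring_axioms ring_axioms])
  show ?thesis using ideal_vimage[OF assms] by (simp add: Int_def)
qed

text \<open>Both witnesses are required in \<open>A\<close>, not merely in \<open>B\<close>: they
  serve as coefficients in the Chinese remainder argument, and products of elements of
  \<open>A\<close> with them must stay in \<open>A\<close>.\<close>

definition comaximal_in_base :: "'a set \<Rightarrow> 'a set \<Rightarrow> bool"
  where "comaximal_in_base I J \<longleftrightarrow> (\<exists>u \<in> A \<inter> I. \<exists>v \<in> A \<inter> J. u \<oplus> v = \<one>)"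

lemma comaximal_in_base_sym:
  assumes "comaximal_in_base I J"
  shows "comaximal_in_base J I"
proof -
  obtain u v where "u \<in> A \<inter> I" "v \<in> A \<inter> J" "u \<oplus> v = \<one>"
    using assms by (auto simp: comaximal_in_base_def)
  moreover from this have "v \<oplus> u = \<one>" by (simp add: a_comm)
  ultimately show ?thesis unfolding comaximal_in_base_def by blast
qed

lemma comaximal_in_base_carrier:
  assumes "ideal I B"
  shows "comaximal_in_base I (carrier B)"
proof -
  interpret ideal I B by fact
  show ?thesis
    unfolding comaximal_in_base_def
    using subringE(2,3)[OF subring] zero_closed
    by (intro bexI[of _ \<zero>] bexI[of _ \<one>]) auto
qed

lemma comaximal_in_base_prod:
  assumes "ideal I B" "ideal J B" "ideal J' B" "comaximal_in_base I J" "comaximal_in_base I J'"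
  shows "comaximal_in_base I (J \<cdot> J')"
proof -
  interpret I: ideal I B by fact
  obtain u v where uv: "u \<in> A" "u \<in> I" "v \<in> A" "v \<in> J" "u \<oplus> v = \<one>"
    using assms(4) by (auto simp: comaximal_in_base_def)
  obtain u' v' where uv': "u' \<in> A" "u' \<in> I" "v' \<in> A" "v' \<in> J'" "u' \<oplus> v' = \<one>"
    using assms(5) by (auto simp: comaximal_in_base_def)
  \<comment> \<open>Inserting \<open>u' \<oplus> v' = \<one>\<close> as a factor after
    \<open>v\<close> in \<open>u \<oplus> v = \<one>\<close> leaves a part in \<open>I\<close> and
    the term \<open>v \<otimes> v'\<close> in \<open>J \<cdot> J'\<close>.\<close>
  have "(u \<oplus> v \<otimes> u') \<oplus> v \<otimes> v' = u \<oplus> v \<otimes> (u' \<oplus> v')"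
    using uv(1,3) uv'(1,3) by (simp add: r_distr a_assoc)
  also have "\<dots> = \<one>" using uv uv' by simp
  finally have "(u \<oplus> v \<otimes> u') \<oplus> v \<otimes> v' = \<one>" .
  moreover have "u \<oplus> v \<otimes> u' \<in> A \<inter> I"
    using uv uv' subringE(6,7)[OF subring] by (auto intro!: I.a_closed I.I_l_closed)
  moreover have "v \<otimes> v' \<in> A \<inter> (J \<cdot> J')"
    using uv uv' subringE(6)[OF subring] ideal_prod.prod[of v J v' J'] by auto
  ultimately show ?thesis unfolding comaximal_in_base_def by blast
qed

lemma comaximal_in_base_pow:
  assumes "ideal I B" "ideal J B" "comaximal_in_base I J"
  shows "comaximal_in_base I (J [^]\<^bsub>ideals_set B\<^esub> (n::nat))"
proof (induct n)
  case 0
  then show ?case using comaximal_in_base_carrier[OF assms(1)] by simp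
next
  case (Suc n)
  then show ?case
    unfolding ideal_pow_Suc[OF assms(2)]
    by (intro comaximal_in_base_prod assms ideal_pow_closed)
qed

lemma comaximal_in_base_finprod:
  assumes "ideal I B" "finite F"
    and "\<And>i. i \<in> F \<Longrightarrow> ideal (f i) B" "\<And>i. i \<in> F \<Longrightarrow> comaximal_in_base I (f i)"
  shows "comaximal_in_base I (\<Otimes>\<^bsub>ideals_set B\<^esub>i\<in>F. f i)"
  using assms(2-)
proof (induct F)
  case empty
  then show ?case using comaximal_in_base_carrier[OF assms(1)] by (simp add: finprod_ideal_empty)
next
  case (insert i F)
  then have "(\<Otimes>\<^bsub>ideals_set B\<^esub>j\<in>insert i F. f j) = f i \<cdot> (\<Otimes>\<^bsub>ideals_set B\<^esub>j\<in>F. f j)"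
    by (intro finprod_ideal_insert) auto
  then show ?case
    using insert by (auto intro!: comaximal_in_base_prod assms(1) finprod_ideal)
qed

text \<open>Distinct contractions are distinct maximal ideals of \<open>A\<close>, so one is not
  contained in the other and \<open>\<one>\<close> splits inside \<open>A\<close>.\<close>

lemma contractions_comaximal:
  assumes "nonzero_prime_ideal B q" "nonzero_prime_ideal B q'" "A \<inter> q \<noteq> A \<inter> q'"
  shows "comaximal_in_base q q'"
proof -
  have m: "maximalideal (A \<inter> q) base" and m': "maximalideal (A \<inter> q') base"
    using assms contraction_maximalideal by simp_all
  interpret m: maximalideal "A \<inter> q" base by fact
  interpret m': maximalideal "A \<inter> q'" base by fact
  have "\<not> A \<inter> q \<subseteq> A \<inter> q'"
    using m.I_maximal[OF m'.is_ideal] m'.I_notcarr assms(3) by auto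
  then show ?thesis
    using maximal_base_comaximal[OF m' m.is_ideal]
    unfolding comaximal_in_base_def by blast
qed

section \<open>Representing \<open>B\<close> by \<open>A\<close> modulo an ideal, and the Chinese
  remainder step\<close>

definition covers :: "'a set \<Rightarrow> bool"
  where "covers I \<longleftrightarrow> (\<forall>x \<in> carrier B. \<exists>a \<in> A. \<exists>z \<in> I. x = a \<oplus> z)"

lemma degree_one_iff_covers:
  "degree_one B A I \<longleftrightarrow> ideal I B \<and> I \<noteq> carrier B \<and> covers I"
proof (cases "ideal I B")
  \<comment> \<open>The condition \<open>covers\<close> expresses \<open>A + I = B\<close>
    elementwise and leaves properness aside. Thus the unit ideal satisfies it, which starts the
    inductions at the empty product and at exponent zero.\<close>
  case True
  interpret ideal I B by fact
  have "A <+>\<^bsub>B\<^esub> I \<subseteq> carrier B" by (auto simp: set_add_def')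
  moreover have "covers I \<longleftrightarrow> carrier B \<subseteq> A <+>\<^bsub>B\<^esub> I"
    unfolding covers_def set_add_def' by blast
  ultimately show ?thesis unfolding degree_one_def by blast
qed (simp add: degree_one_def)

lemma covers_carrier: "covers (carrier B)"
  unfolding covers_def using subringE(2)[OF subring] by (metis l_zero)

lemma covers_prod:
  assumes "ideal I B" "ideal J B" "covers I" "covers J" "comaximal_in_base I J"
  shows "covers (I \<cdot> J)"
  unfolding covers_def
proof
  interpret I: ideal I B by fact
  interpret J: ideal J B by fact
  fix x assume x: "x \<in> carrier B"
  obtain u v where uv: "u \<in> A" "u \<in> I" "v \<in> A" "v \<in> J" "u \<oplus> v = \<one>"
    using assms(5) by (auto simp: comaximal_in_base_def)
  obtain a i where ai: "a \<in> A" "i \<in> I" "x = a \<oplus> i" using assms(3) x by (auto simp: covers_def)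
  obtain b j where bj: "b \<in> A" "j \<in> J" "x = b \<oplus> j" using assms(4) x by (auto simp: covers_def)
  have carr: "u \<in> carrier B" "v \<in> carrier B" "a \<in> carrier B" "i \<in> carrier B"
    "b \<in> carrier B" "j \<in> carrier B"
    using uv ai bj by auto
  have "x = (u \<oplus> v) \<otimes> x" using uv x by simp
  \<comment> \<open>The representations are crossed: \<open>u \<in> I\<close> multiplies the one
    modulo \<open>J\<close>, and \<open>v \<in> J\<close> the one modulo \<open>I\<close>. Both
    error terms then fall into \<open>I \<cdot> J\<close>, while the main terms stay in
    \<open>A\<close>.\<close>
  also have "\<dots> = u \<otimes> (b \<oplus> j) \<oplus> v \<otimes> (a \<oplus> i)"
    using carr x ai(3) bj(3) by (metis l_distr)
  also have "\<dots> = (u \<otimes> b \<oplus> v \<otimes> a) \<oplus> (u \<otimes> j \<oplus> i \<otimes> v)"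
    using carr by algebra
  finally have "x = (u \<otimes> b \<oplus> v \<otimes> a) \<oplus> (u \<otimes> j \<oplus> i \<otimes> v)" .
  moreover have "u \<otimes> b \<oplus> v \<otimes> a \<in> A"
    using uv ai bj subringE(6,7)[OF subring] by simp
  moreover have "u \<otimes> j \<oplus> i \<otimes> v \<in> I \<cdot> J"
    using uv ai bj by (auto intro: ideal_prod.intros)
  ultimately show "\<exists>a\<in>A. \<exists>z\<in>I \<cdot> J. x = a \<oplus> z" by blast
qed

lemma covers_finprod:
  assumes "finite F" "\<And>i. i \<in> F \<Longrightarrow> ideal (f i) B" "\<And>i. i \<in> F \<Longrightarrow> covers (f i)"
    and "\<And>i j. i \<in> F \<Longrightarrow> j \<in> F \<Longrightarrow> i \<noteq> j \<Longrightarrow> comaximal_in_base (f i) (f j)"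
  shows "covers (\<Otimes>\<^bsub>ideals_set B\<^esub>i\<in>F. f i)"
  using assms
proof (induct F)
  case empty
  then show ?case using covers_carrier by (simp add: finprod_ideal_empty)
next
  case (insert i F)
  then have "(\<Otimes>\<^bsub>ideals_set B\<^esub>j\<in>insert i F. f j) = f i \<cdot> (\<Otimes>\<^bsub>ideals_set B\<^esub>j\<in>F. f j)"
    by (intro finprod_ideal_insert) auto
  moreover have "comaximal_in_base (f i) (\<Otimes>\<^bsub>ideals_set B\<^esub>j\<in>F. f j)"
    using insert by (intro comaximal_in_base_finprod) auto
  ultimately show ?case
    using insert by (auto intro!: covers_prod finprod_ideal)
qed

section \<open>Unramified primes of degree one and their powers\<close>

lemma degree_one_prime_comaximal:
  assumes "nonzero_prime_ideal B q" "covers q" "ideal J B" "\<not> J \<subseteq> q"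
  shows "\<exists>u \<in> J. \<exists>v \<in> q. u \<oplus> v = \<one>"
proof -
  interpret q: primeideal q B using assms by (simp add: nonzero_prime_ideal_def)
  interpret J: ideal J B by fact
  obtain x where x: "x \<in> J" "x \<notin> q" using assms by blast
  obtain a z where az: "a \<in> A" "z \<in> q" "x = a \<oplus> z"
    using assms(2) J.Icarr[OF x(1)] by (auto simp: covers_def)
  have carr: "a \<in> carrier B" "z \<in> carrier B" using az by auto
  \<comment> \<open>Modulo \<open>q\<close> the element \<open>x\<close> of \<open>J\<close> agrees
    with \<open>a \<in> A\<close>. Hence \<open>J + q\<close> meets \<open>A\<close> outside
    \<open>q\<close>, and maximality of \<open>A \<inter> q\<close> in \<open>A\<close> suffices to
    split \<open>\<one>\<close>.\<close>
  have "a = x \<oplus> \<ominus> z" unfolding az(3) using carr by algebra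
  then have "a \<in> A \<inter> (J <+>\<^bsub>B\<^esub> q)" using az x by (auto simp: set_add_def')
  moreover have "a \<notin> q" using az x by auto
  ultimately have "\<not> A \<inter> (J <+>\<^bsub>B\<^esub> q) \<subseteq> A \<inter> q" by blast
  then obtain w v where wv: "w \<in> A \<inter> (J <+>\<^bsub>B\<^esub> q)" "v \<in> A \<inter> q" "w \<oplus> v = \<one>"
    using maximal_base_comaximal[OF contraction_maximalideal[OF assms(1)]
        contraction_ideal[OF add_ideals[OF J.is_ideal q.is_ideal]]] by blast
  then obtain j y where jy: "j \<in> J" "y \<in> q" "w = j \<oplus> y" by (auto simp: set_add_def')
  then have "j \<oplus> (y \<oplus> v) = \<one>" using wv by (simp add: a_assoc)
  then show ?thesis using jy wv by blast
qed

text \<open>Since \<open>B = A + q\<close>, multiplying an element of \<open>A \<inter> q\<close> by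
  one of \<open>B\<close> leaves \<open>A \<inter> q\<close> only by an error in
  \<open>q \<cdot> q\<close>. So the right-hand side is already an ideal of \<open>B\<close>, and
  minimality of the generated ideal applies.\<close>

lemma extension_of_contraction_subset:
  assumes "ideal q B" "covers q"
  shows "Idl (A \<inter> q) \<subseteq> (A \<inter> q) <+>\<^bsub>B\<^esub> q \<cdot> q"
proof (rule genideal_minimal)
  interpret q: ideal q B by fact
  interpret qq: ideal "q \<cdot> q" B by (rule ideal_prod_is_ideal) fact+
  interpret p: ideal "A \<inter> q" base by (rule contraction_ideal) fact
  show "A \<inter> q \<subseteq> (A \<inter> q) <+>\<^bsub>B\<^esub> q \<cdot> q"
  proof
    fix x assume "x \<in> A \<inter> q"
    moreover from this have "x = x \<oplus> \<zero>" by simp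
    ultimately show "x \<in> (A \<inter> q) <+>\<^bsub>B\<^esub> q \<cdot> q"
      unfolding set_add_def' using qq.zero_closed by blast
  qed
  have "additive_subgroup (A \<inter> q) B"
    using subring by (auto intro!: additive_subgroup.intro add.subgroups_Inter_pair q.a_subgroup
      simp: subring_def)
  then interpret s: additive_subgroup "(A \<inter> q) <+>\<^bsub>B\<^esub> q \<cdot> q" B
    by (rule add_additive_subgroups) (rule qq.additive_subgroup_axioms)
  have closed: "x \<otimes> s \<in> (A \<inter> q) <+>\<^bsub>B\<^esub> q \<cdot> q"
    if s: "s \<in> (A \<inter> q) <+>\<^bsub>B\<^esub> q \<cdot> q" and x: "x \<in> carrier B" for s x
  proof -
    obtain p w where pw: "p \<in> A" "p \<in> q" "w \<in> q \<cdot> q" "s = p \<oplus> w"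
      using s by (auto simp: set_add_def')
    obtain a z where az: "a \<in> A" "z \<in> q" "x = a \<oplus> z"
      using assms(2) x by (auto simp: covers_def)
    have "x \<otimes> s = a \<otimes> p \<oplus> (z \<otimes> p \<oplus> x \<otimes> w)"
      unfolding pw(4) using x pw(1-3) az
      by (simp add: r_distr l_distr a_assoc)
    moreover have "a \<otimes> p \<in> A \<inter> q"
      using pw az subringE(6)[OF subring] q.I_l_closed by simp
    moreover have "z \<otimes> p \<oplus> x \<otimes> w \<in> q \<cdot> q"
      using pw az x by (intro qq.a_closed ideal_prod.prod qq.I_l_closed) auto
    ultimately show ?thesis unfolding set_add_def' by blast
  qed
  show "ideal ((A \<inter> q) <+>\<^bsub>B\<^esub> q \<cdot> q) B"
  proof (rule idealI[OF ring_axioms s.a_subgroup closed])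
    fix s x assume "s \<in> (A \<inter> q) <+>\<^bsub>B\<^esub> q \<cdot> q" "x \<in> carrier B"
    then show "s \<otimes> x \<in> (A \<inter> q) <+>\<^bsub>B\<^esub> q \<cdot> q"
      using closed[of s x] m_comm s.a_Hcarr by metis
  qed
qed

text \<open>Exponent one lets \<open>q\<close> be split off exactly once; \<open>c\<close> collects
  the powers of the remaining primes. If \<open>q\<close> contained \<open>c\<close>, it would
  contain one of these primes and hence equal it by \<open>nonzero_primes_eq\<close>.\<close>

lemma unramified_prime_factorisation:
  assumes "nonzero_prime_ideal B q" "has_ramification_index B A q 1"
  obtains c where "ideal c B" "Idl (A \<inter> q) = q \<cdot> c" "\<not> c \<subseteq> q"
proof -
  interpret q: primeideal q B using assms by (simp add: nonzero_prime_ideal_def)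
  interpret M: comm_monoid "ideals_set B" by (rule ideals_set_is_comm_monoid)
  obtain n where n: "finite {p. n p \<noteq> 0}" "\<And>p. n p \<noteq> 0 \<Longrightarrow> nonzero_prime_ideal B p"
    "Idl (A \<inter> q) = (\<Otimes>\<^bsub>ideals_set B\<^esub>p\<in>{p. n p \<noteq> 0}. p [^]\<^bsub>ideals_set B\<^esub> n p)" "n q = (1::nat)"
  proof -
    obtain n where "prime_ideal_factorisation B (Idl (A \<inter> q)) n" "n q = 1"
      using assms(2) by (auto simp: has_ramification_index_def)
    then show thesis
      by (intro that[of n]) (simp_all add: prime_ideal_factorisation_def)
  qed
  define F where "F = {p. n p \<noteq> 0} - {q}"
  define c where "c = (\<Otimes>\<^bsub>ideals_set B\<^esub>p\<in>F. p [^]\<^bsub>ideals_set B\<^esub> n p)"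
  have F: "finite F" "{p. n p \<noteq> 0} = insert q F" "q \<notin> F" using n by (auto simp: F_def)
  have prime: "nonzero_prime_ideal B p" if "p \<in> insert q F" for p using that n(2) F(2) by auto
  have ideal: "ideal p B" if "p \<in> insert q F" for p
    using prime[OF that] by (simp add: nonzero_prime_ideal_def primeideal.axioms(1))
  have pow: "ideal (p [^]\<^bsub>ideals_set B\<^esub> n p) B" if "p \<in> insert q F" for p
    using ideal_pow_closed ideal[OF that] .
  show thesis
  proof (rule that)
    show "ideal c B" unfolding c_def using pow by (intro finprod_ideal) auto
    have "q [^]\<^bsub>ideals_set B\<^esub> n q = q" using n(4) M.nat_pow_eone[of q] q.is_ideal by simp
    then show "Idl (A \<inter> q) = q \<cdot> c"
      unfolding n(3) F(2) c_def using finprod_ideal_insert[OF F(1,3) pow] by simp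
    show "\<not> c \<subseteq> q"
    proof
      assume "c \<subseteq> q"
      then obtain p where p: "p \<in> F" "p [^]\<^bsub>ideals_set B\<^esub> n p \<subseteq> q"
        using q.ideal_finprod_subset_prime[OF F(1), of "\<lambda>p. p [^]\<^bsub>ideals_set B\<^esub> n p"] pow
        unfolding c_def by auto
      then have "p \<subseteq> q" using q.ideal_pow_subset_prime[OF ideal p(2)] by simp
      then have "p = q" using nonzero_primes_eq[OF assms(1) prime] p by simp
      then show False using p F by blast
    qed
  qed
qed

text \<open>With \<open>u \<in> c\<close>, \<open>v \<in> q\<close> and
  \<open>u \<oplus> v = \<one>\<close>, the part \<open>x \<otimes> u\<close> lies in
  \<open>q \<cdot> c\<close>, the extension of \<open>A \<inter> q\<close>, and
  \<open>x \<otimes> v\<close> lies in \<open>q \<cdot> q\<close>. Having \<open>a\<close> in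
  \<open>q\<close> as well as in \<open>A\<close> is what makes the induction on powers
  work.\<close>

lemma unramified_degree_one_prime_decomp:
  assumes "nonzero_prime_ideal B q" "covers q" "has_ramification_index B A q 1" "x \<in> q"
  shows "\<exists>a \<in> A \<inter> q. \<exists>z \<in> q \<cdot> q. x = a \<oplus> z"
proof -
  interpret q: primeideal q B using assms by (simp add: nonzero_prime_ideal_def)
  interpret qq: ideal "q \<cdot> q" B by (rule ideal_prod_is_ideal) (rule q.is_ideal)+
  obtain c where c: "ideal c B" "Idl (A \<inter> q) = q \<cdot> c" "\<not> c \<subseteq> q"
    using unramified_prime_factorisation[OF assms(1,3)] .
  interpret c: ideal c B by fact
  obtain u v where uv: "u \<in> c" "v \<in> q" "u \<oplus> v = \<one>"
    using degree_one_prime_comaximal[OF assms(1,2) c(1,3)] by blast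
  have "x \<otimes> u \<in> Idl (A \<inter> q)" unfolding c(2) using assms(4) uv by (auto intro: ideal_prod.prod)
  then obtain a w where aw: "a \<in> A \<inter> q" "w \<in> q \<cdot> q" "x \<otimes> u = a \<oplus> w"
    using extension_of_contraction_subset[OF q.is_ideal assms(2)] by (auto simp: set_add_def')
  have xv: "x \<otimes> v \<in> q \<cdot> q" using assms(4) uv by (auto intro: ideal_prod.prod)
  have "x = x \<otimes> (u \<oplus> v)" using uv assms(4) by simp
  also have "\<dots> = x \<otimes> u \<oplus> x \<otimes> v" using uv(1,2) assms(4) by (simp add: r_distr)
  also have "\<dots> = a \<oplus> (w \<oplus> x \<otimes> v)" using aw xv by (simp add: a_assoc)
  finally show ?thesis using aw xv by blast
qed

lemma unramified_degree_one_pow_decomp: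
  assumes "nonzero_prime_ideal B q" "covers q" "has_ramification_index B A q 1"
    and "x \<in> q [^]\<^bsub>ideals_set B\<^esub> (n::nat)"
  shows "\<exists>a \<in> A. \<exists>z \<in> q [^]\<^bsub>ideals_set B\<^esub> Suc n. x = a \<oplus> z"
  using assms(4)
proof (induct n arbitrary: x)
  interpret q: primeideal q B using assms by (simp add: nonzero_prime_ideal_def)
  interpret M: comm_monoid "ideals_set B" by (rule ideals_set_is_comm_monoid)
  case 0
  \<comment> \<open>At exponent zero the claim is \<open>covers q\<close>, the zeroth power being
    \<open>carrier B\<close> and the first \<open>q\<close>.\<close>
  then show ?case
    using assms(2) M.nat_pow_eone[of q] q.is_ideal by (simp add: covers_def)
next
  interpret q: primeideal q B using assms by (simp add: nonzero_prime_ideal_def)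
  case (Suc n)
  let ?pow = "\<lambda>k::nat. q [^]\<^bsub>ideals_set B\<^esub> k"
  have pow: "ideal (?pow k) B" for k by (rule ideal_pow_closed) (rule q.is_ideal)
  interpret p0: ideal "?pow n" B by (rule pow)
  interpret p1: ideal "?pow (Suc n)" B by (rule pow)
  interpret p2: ideal "?pow (Suc (Suc n))" B by (rule pow)
  note pow_Suc = ideal_pow_Suc[OF q.is_ideal]
  \<comment> \<open>This regrouping receives the terms whose first factor already has order
    two.\<close>
  have pow2: "?pow (Suc (Suc n)) = (q \<cdot> q) \<cdot> ?pow n"
    unfolding pow_Suc by (intro ideal_prod_assoc[symmetric] q.is_ideal pow)
  have "x \<in> q \<cdot> ?pow n" using Suc.prems unfolding pow_Suc .
  \<comment> \<open>Induction over the generation of the ideal product, by products of elements and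
    by sums.\<close>
  then show ?case
  proof induct
    case (prod i j)
    obtain a z where az: "a \<in> A \<inter> q" "z \<in> q \<cdot> q" "i = a \<oplus> z"
      using unramified_degree_one_prime_decomp[OF assms(1-3) prod(1)] by blast
    obtain b y where bj: "b \<in> A" "y \<in> ?pow (Suc n)" "j = b \<oplus> y"
      using Suc.hyps[OF prod(2)] by blast
    have carr: "a \<in> carrier B" "z \<in> carrier B" "b \<in> carrier B" "y \<in> carrier B"
      using az bj ideal_prod_in_carrier[OF q.is_ideal q.is_ideal] p1.Icarr by auto
    \<comment> \<open>Each error term gains one order: in \<open>a \<otimes> y\<close> through
      \<open>y\<close>, with \<open>a\<close> still in \<open>q\<close>, and in
      \<open>z \<otimes> j\<close> through \<open>z \<in> q \<cdot> q\<close>.\<close>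
    have "i \<otimes> j = a \<otimes> b \<oplus> (a \<otimes> y \<oplus> z \<otimes> j)"
      unfolding az(3) bj(3) using carr by algebra
    moreover have "a \<otimes> b \<in> A" using az bj subringE(6)[OF subring] by simp
    moreover have "a \<otimes> y \<in> ?pow (Suc (Suc n))"
      unfolding pow_Suc[of "Suc n"] using az bj by (auto intro: ideal_prod.prod)
    moreover have "z \<otimes> j \<in> ?pow (Suc (Suc n))"
      unfolding pow2 using az prod by (auto intro: ideal_prod.prod)
    ultimately show ?case using p2.a_closed by blast
  next
    case (sum s t)
    then obtain a z b y where *: "a \<in> A" "z \<in> ?pow (Suc (Suc n))" "s = a \<oplus> z"
      "b \<in> A" "y \<in> ?pow (Suc (Suc n))" "t = b \<oplus> y" by blast
    then have carr: "a \<in> carrier B" "z \<in> carrier B" "b \<in> carrier B" "y \<in> carrier B"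
      using p2.Icarr by auto
    have "s \<oplus> t = (a \<oplus> b) \<oplus> (z \<oplus> y)" unfolding * using carr by algebra
    then show ?case using * subringE(7)[OF subring] p2.a_closed by blast
  qed
qed

lemma covers_unramified_pow:
  assumes "nonzero_prime_ideal B q" "covers q" "has_ramification_index B A q 1"
  shows "covers (q [^]\<^bsub>ideals_set B\<^esub> (n::nat))"
proof (induct n)
  case 0
  then show ?case using covers_carrier by simp
next
  case (Suc n)
  interpret q: primeideal q B using assms by (simp add: nonzero_prime_ideal_def)
  interpret pow: ideal "q [^]\<^bsub>ideals_set B\<^esub> Suc n" B by (rule ideal_pow_closed) (rule q.is_ideal)
  show ?case
    unfolding covers_def
  proof
    fix x assume "x \<in> carrier B"
    then obtain a z where az: "a \<in> A" "z \<in> q [^]\<^bsub>ideals_set B\<^esub> n" "x = a \<oplus> z"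
      using Suc unfolding covers_def by blast
    \<comment> \<open>Successive approximation: the remainder \<open>z\<close> is split once more,
      and the two parts from \<open>A\<close> are added.\<close>
    obtain b y where bj: "b \<in> A" "y \<in> q [^]\<^bsub>ideals_set B\<^esub> Suc n" "z = b \<oplus> y"
      using unramified_degree_one_pow_decomp[OF assms az(2)] by blast
    have "x = (a \<oplus> b) \<oplus> y"
      unfolding az(3) bj(3) using az(1) bj(1) pow.Icarr[OF bj(2)] by (simp add: a_assoc)
    then show "\<exists>a\<in>A. \<exists>z\<in>q [^]\<^bsub>ideals_set B\<^esub> Suc n. x = a \<oplus> z"
      using az bj subringE(7)[OF subring] by blast
  qed
qed

section \<open>Products of prime powers over distinct primes of \<open>A\<close>\<close>

lemma degree_one_prod_pow:
  fixes e :: "'i \<Rightarrow> nat"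
  assumes "finite F" "F \<noteq> {}"
    and "\<And>i. i \<in> F \<Longrightarrow> nonzero_prime_ideal B (q i)"
    and "\<And>i j. i \<in> F \<Longrightarrow> j \<in> F \<Longrightarrow> i \<noteq> j \<Longrightarrow> A \<inter> q i \<noteq> A \<inter> q j"
    and "\<And>i. i \<in> F \<Longrightarrow> degree_one B A (q i)"
    and "\<And>i. i \<in> F \<Longrightarrow> has_ramification_index B A (q i) 1"
    and "\<And>i. i \<in> F \<Longrightarrow> e i > 0"
  shows "degree_one B A (\<Otimes>\<^bsub>ideals_set B\<^esub>i\<in>F. q i [^]\<^bsub>ideals_set B\<^esub> e i)"
proof -
  let ?f = "\<lambda>i. q i [^]\<^bsub>ideals_set B\<^esub> e i"
  have ideal: "ideal (q i) B" and covers: "covers (q i)" and proper: "q i \<noteq> carrier B"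
    if "i \<in> F" for i
    using assms(5)[OF that] by (simp_all add: degree_one_iff_covers)
  have pow: "ideal (?f i) B" if "i \<in> F" for i
    by (rule ideal_pow_closed[OF ideal[OF that]])
  have comax: "comaximal_in_base (?f i) (?f j)" if "i \<in> F" "j \<in> F" "i \<noteq> j" for i j
  proof -
    have "comaximal_in_base (q i) (q j)"
      using contractions_comaximal[OF assms(3)[OF that(1)] assms(3)[OF that(2)]] assms(4)[OF that]
      by simp
    \<comment> \<open>Only the second ideal can be raised to a power, so the sides are exchanged
      before the other power is taken.\<close>
    then have "comaximal_in_base (q i) (?f j)"
      by (rule comaximal_in_base_pow[OF ideal[OF that(1)] ideal[OF that(2)]])
    then have "comaximal_in_base (?f j) (?f i)"
      by (rule comaximal_in_base_pow[OF pow[OF that(2)] ideal[OF that(1)] comaximal_in_base_sym])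
    then show ?thesis by (rule comaximal_in_base_sym)
  qed
  have "covers (\<Otimes>\<^bsub>ideals_set B\<^esub>i\<in>F. ?f i)"
  proof (rule covers_finprod[OF assms(1)])
    show "ideal (?f i) B" if "i \<in> F" for i using pow[OF that] .
    show "covers (?f i)" if "i \<in> F" for i
      using covers_unramified_pow[OF assms(3)[OF that] covers[OF that] assms(6)[OF that]] .
    show "comaximal_in_base (?f i) (?f j)" if "i \<in> F" "j \<in> F" "i \<noteq> j" for i j
      using comax[OF that] .
  qed
  \<comment> \<open>Properness uses that \<open>F\<close> is non-empty and the exponents are
    positive: some \<open>q k\<close> really divides the product, which is therefore contained in a
    proper ideal.\<close>
  moreover have "(\<Otimes>\<^bsub>ideals_set B\<^esub>i\<in>F. ?f i) \<noteq> carrier B"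
  proof -
    obtain k where k: "k \<in> F" using assms(2) by blast
    obtain m where m: "e k = Suc m" using assms(7)[OF k] gr0_implies_Suc by blast
    let ?P = "\<Otimes>\<^bsub>ideals_set B\<^esub>i\<in>F - {k}. ?f i"
    have P: "ideal ?P B" by (rule finprod_ideal) (use pow in simp)
    have "(\<Otimes>\<^bsub>ideals_set B\<^esub>i\<in>insert k (F - {k}). ?f i) = ?f k \<cdot> ?P"
      by (rule finprod_ideal_insert) (use assms(1) k pow in auto)
    then have "(\<Otimes>\<^bsub>ideals_set B\<^esub>i\<in>F. ?f i) = ?f k \<cdot> ?P" by (simp only: insert_Diff[OF k])
    also have "\<dots> \<subseteq> ?f k" using ideal_prod_inter[OF pow[OF k] P] by blast
    also have "?f k = q k \<cdot> (q k [^]\<^bsub>ideals_set B\<^esub> m)"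
      unfolding m by (rule ideal_pow_Suc[OF ideal[OF k]])
    also have "\<dots> \<subseteq> q k"
      using ideal_prod_inter[OF ideal[OF k] ideal_pow_closed[OF ideal[OF k]]] by blast
    finally have sub: "(\<Otimes>\<^bsub>ideals_set B\<^esub>i\<in>F. ?f i) \<subseteq> q k" .
    have "q k \<subset> carrier B" using ideal.Icarr[OF ideal[OF k]] proper[OF k] by auto
    then show ?thesis using sub by auto
  qed
  ultimately show ?thesis using pow by (simp add: degree_one_iff_covers finprod_ideal)
qed

end

section \<open>Application to the integral closure of \<open>A\<close> in \<open>L\<close>\<close>

theorem proposition2p4:
  fixes L :: "('a, 'b) ring_scheme" and A K B :: "'a set" and \<B> :: "('a, 'b) ring_scheme"
  assumes "field L"
    and "field.dedekind_subdomain L A"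
    and "K = field.fraction_field L A"
    and "ring.finite_dimension L K (carrier L)"
    and "field.separable_extension L K"
    and "B = ring.integral_closure L A (carrier L)"
    and "\<B> = L \<lparr> carrier := B \<rparr>"
  shows "(\<forall>b q. degree_one \<B> A b \<and> prime_ideal_factor \<B> q b \<longrightarrow> degree_one \<B> A q) \<and>
         (\<forall>(r::nat) (q :: nat \<Rightarrow> 'a set) (e :: nat \<Rightarrow> nat).
            r \<ge> 1 \<and>
            (\<forall>i\<in>{1..r}. nonzero_prime_ideal \<B> (q i)) \<and>
            (\<forall>i\<in>{1..r}. \<forall>j\<in>{1..r}. i \<noteq> j \<longrightarrow> A \<inter> q i \<noteq> A \<inter> q j) \<and>
            (\<forall>i\<in>{1..r}. degree_one \<B> A (q i) \<and> has_ramification_index \<B> A (q i) 1) \<and>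
            (\<forall>i\<in>{1..r}. e i > 0)
            \<longrightarrow> degree_one \<B> A (\<Otimes>\<^bsub>ideals_set \<B>\<^esub>i\<in>{1..r}. q i [^]\<^bsub>ideals_set \<B>\<^esub> e i))"
proof -
  interpret L: field L by fact
  have A: "subring A L" and max: "\<And>P. primeideal P (L\<lparr>carrier := A\<rparr>) \<Longrightarrow> P \<noteq> {\<zero>\<^bsub>L\<^esub>}
      \<Longrightarrow> maximalideal P (L\<lparr>carrier := A\<rparr>)"
    using assms(2) unfolding L.dedekind_subdomain_def by blast+
  have BL: "B \<subseteq> carrier L" and B: "\<And>x. x \<in> B \<Longrightarrow> L.integral_over A x"
    using assms(6) by (auto simp: L.integral_closure_def)
  \<comment> \<open>The proof that integral elements form a ring is bypassed: an ideal of degree one carries the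
    ring structure of \<open>B\<close> and the inclusion of \<open>A\<close> with it.\<close>
  have ext: "integral_ring_extension \<B> A" if b: "degree_one \<B> A b" for b
  proof -
    interpret b: ideal b \<B> using b by (simp add: degree_one_def)
    have sub: "subring B L"
      using L.ring_incl_imp_subring[OF BL] b.ring_axioms assms(7) by simp
    have AB: "A \<subseteq> B"
    proof
      fix a assume a: "a \<in> A"
      \<comment> \<open>As \<open>b\<close> contains zero, \<open>A\<close> lies in
        \<open>A + b\<close>, which is all of \<open>B\<close> by degree one.\<close>
      have "\<zero>\<^bsub>L\<^esub> \<in> b"
        using additive_subgroup.zero_closed[OF b.additive_subgroup_axioms] assms(7) by simp
      then have "a \<oplus>\<^bsub>L\<^esub> \<zero>\<^bsub>L\<^esub> \<in> A <+>\<^bsub>\<B>\<^esub> b"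
        using a assms(7) unfolding set_add_def' by auto
      moreover have "a \<in> carrier L" using a subringE(1)[OF A] by blast
      ultimately show "a \<in> B" using b assms(7) by (simp add: degree_one_def)
    qed
    have base: "\<B>\<lparr>carrier := A\<rparr> = L\<lparr>carrier := A\<rparr>" using assms(7) by simp
    show ?thesis
    proof (intro integral_ring_extension.intro integral_ring_extension_axioms.intro)
      show "domain \<B>" using L.subring_is_domain[OF sub] assms(7) by simp
      show "subring A \<B>"
        using b.ring_incl_imp_subring[of A] AB L.subring_is_ring[OF A] base assms(7) by simp
      show "ring.integral_over \<B> A x" if "x \<in> carrier \<B>" for x
      proof -
        have "L.integral_over A x" using B that assms(7) by simp
        \<comment> \<open>The polynomials are the same coefficient lists over \<open>A\<close> in
          both rings, so only evaluation in \<open>\<B>\<close> and in \<open>L\<close> has to be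
          compared.\<close>
        then show ?thesis
          unfolding L.integral_over_def ring.integral_over_def[OF b.ring_axioms]
          using L.eval_consistent[OF sub] assms(7) by (simp add: univ_poly_def polynomial_def)
      qed
      show "maximalideal P (\<B>\<lparr>carrier := A\<rparr>)"
        if "primeideal P (\<B>\<lparr>carrier := A\<rparr>)" "P \<noteq> {\<zero>\<^bsub>\<B>\<^esub>}" for P
        using that max unfolding base assms(7) by simp
    qed
  qed
  show ?thesis
  proof (intro conjI allI impI; elim conjE)
    fix b q
    assume b: "degree_one \<B> A b" and fac: "prime_ideal_factor \<B> q b"
    interpret E: integral_ring_extension \<B> A by (rule ext) fact
    obtain b' where b': "primeideal q \<B>" "ideal b' \<B>" "b = q \<cdot>\<^bsub>\<B>\<^esub> b'"
      using fac unfolding prime_ideal_factor_def nonzero_prime_ideal_def by blast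
    interpret q: primeideal q \<B> by fact
    have "b \<subseteq> q" using E.ideal_prod_inter[OF q.is_ideal b'(2)] b'(3) by blast
    then show "degree_one \<B> A q"
      using E.degree_one_mono[OF subringE(1)[OF E.subring] b _ q.is_ideal] q.I_notcarr by simp
  next
    fix r :: nat and q :: "nat \<Rightarrow> 'a set" and e :: "nat \<Rightarrow> nat"
    assume r: "r \<ge> 1"
      and q: "\<forall>i\<in>{1..r}. degree_one \<B> A (q i) \<and> has_ramification_index \<B> A (q i) 1"
        "\<forall>i\<in>{1..r}. nonzero_prime_ideal \<B> (q i)"
        "\<forall>i\<in>{1..r}. \<forall>j\<in>{1..r}. i \<noteq> j \<longrightarrow> A \<inter> q i \<noteq> A \<inter> q j"
        "\<forall>i\<in>{1..r}. e i > 0"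
    \<comment> \<open>The assumption \<open>r \<ge> 1\<close> supplies an ideal of degree one,
      through which the locale is entered.\<close>
    have "degree_one \<B> A (q 1)" using q(1) r by simp
    then interpret E: integral_ring_extension \<B> A by (rule ext)
    show "degree_one \<B> A (\<Otimes>\<^bsub>ideals_set \<B>\<^esub>i\<in>{1..r}. q i [^]\<^bsub>ideals_set \<B>\<^esub> e i)"
    proof (rule E.degree_one_prod_pow)
      show "{1..r} \<noteq> {}" using r by simp
    qed (use q in simp_all)
  qed
qed

end
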